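(* The decomposition tree of an ultrametric space $\mathbf{M}=(M,d)$ (viewed as a $2$-structure) is equal to its nerve endowed with the diameter function. That is, the set of robust modules of $\mathbf{M}$, ordered by reverse inclusion, is $\mathrm{Nerv}(\mathbf{M})$ ordered by reverse inclusion, and the label $v(R)$ of every non-singleton robust module $R$ is its diameter $\delta(R)$.
   Context: A metric space $(M,d)$ is ultrametric if $d(x,z)\le\max\{d(x,y),d(y,z)\}$ for all $x,y,z$. $\mathrm{Spec}(\mathbf{M},a)=\{d(a,x):x\in M\}$, $\hat B(a,r)=\{x\in M:d(a,x)\le r\}$, and $\mathrm{Nerv}(\mathbf{M})=\{\hat B(a,r):a\in M,\ r\in\mathrm{Spec}(\mathbf{M},a)\}$. $\delta(A)$ is the diameter of $A$. A $V$-labelled $2$-structure is a pair $(E,v)$ where $v$ is a map from $\{(x,y)\in E\times E:x\ne y\}$ into a set $V$. A subset $A\subseteq E$ is a module if $v(x,y)=v(x,y')$ and $v(y,x)=v(y',x)$ for every $x\in E\setminus A$ and $y,y'\in A$. A module is strong if it is comparable with respect to inclusion to every module it meets. A module is robust if it is the least strong module containing two (not necessarily distinct) elements of $E$. A $2$-structure is symmetric if $v(x,y)=v(y,x)$ for all distinct $x,y$, and hereditary decomposable if every induced substructure on at least three elements has a nontrivial module (one different from the empty set, the singletons and the whole set). An ultrametric space $(M,d)$ is a symmetric hereditary decomposable $2$-structure with $v=d$ on pairs of distinct points. In a symmetric hereditary decomposable $2$-structure, to each non-singleton robust module $R$ there corresponds a value $v(R)\in V$ such that $v(x,y)=v(R)$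 for any two distinct $x,y\in E$ for which $R$ is the least strong module containing $x$ and $y$. The decomposition tree is the set of robust modules ordered by reverse inclusion, with its non-singleton nodes $R$ labelled by $v(R)$. *)

theory Defs
  imports "HOL-Analysis.Analysis"
begin

section \<open>Labelled 2-structures\<close>

text \<open>
  A 2-structure is given by its set of elements \<open>E\<close> and its labelling \<open>v\<close>; the label set is the
  type \<open>'v\<close>. Only the values of \<open>v\<close> at pairs of distinct elements of \<open>E\<close> are ever used, so the
  substructure induced on \<open>F \<subseteq> E\<close> is given by \<open>F\<close> and the same \<open>v\<close>.
\<close>

definition is_module :: "'a set \<Rightarrow> ('a \<Rightarrow> 'a \<Rightarrow> 'v) \<Rightarrow> 'a set \<Rightarrow> bool" where
  "is_module E v A \<longleftrightarrow>
     A \<subseteq> E \<and> (\<forall>x\<in>E - A. \<forall>y\<in>A. \<forall>y'\<in>A. v x y = v x y' \<and> v y x = v y' x)"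

definition strong_module :: "'a set \<Rightarrow> ('a \<Rightarrow> 'a \<Rightarrow> 'v) \<Rightarrow> 'a set \<Rightarrow> bool" where
  "strong_module E v A \<longleftrightarrow>
     is_module E v A \<and> (\<forall>B. is_module E v B \<and> A \<inter> B \<noteq> {} \<longrightarrow> A \<subseteq> B \<or> B \<subseteq> A)"

definition least_strong_module ::
    "'a set \<Rightarrow> ('a \<Rightarrow> 'a \<Rightarrow> 'v) \<Rightarrow> 'a \<Rightarrow> 'a \<Rightarrow> 'a set \<Rightarrow> bool" where
  "least_strong_module E v x y R \<longleftrightarrow>
     strong_module E v R \<and> x \<in> R \<and> y \<in> R \<and>
     (\<forall>S. strong_module E v S \<and> x \<in> S \<and> y \<in> S \<longrightarrow> R \<subseteq> S)"

definition robust_modules :: "'a set \<Rightarrow> ('a \<Rightarrow> 'a \<Rightarrow> 'v) \<Rightarrow> 'a set set" where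
  "robust_modules E v = {R. \<exists>x\<in>E. \<exists>y\<in>E. least_strong_module E v x y R}"

definition symmetric_structure :: "'a set \<Rightarrow> ('a \<Rightarrow> 'a \<Rightarrow> 'v) \<Rightarrow> bool" where
  "symmetric_structure E v \<longleftrightarrow> (\<forall>x\<in>E. \<forall>y\<in>E. x \<noteq> y \<longrightarrow> v x y = v y x)"

definition nontrivial_module :: "'a set \<Rightarrow> ('a \<Rightarrow> 'a \<Rightarrow> 'v) \<Rightarrow> 'a set \<Rightarrow> bool" where
  "nontrivial_module E v A \<longleftrightarrow> is_module E v A \<and> A \<noteq> {} \<and> \<not> is_singleton A \<and> A \<noteq> E"

definition hereditary_decomposable :: "'a set \<Rightarrow> ('a \<Rightarrow> 'a \<Rightarrow> 'v) \<Rightarrow> bool" where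
  "hereditary_decomposable E v \<longleftrightarrow>
     (\<forall>F\<subseteq>E. infinite F \<or> card F \<ge> 3 \<longrightarrow> (\<exists>A. nontrivial_module F v A))"


section \<open>The decomposition tree\<close>

text \<open>Reverse inclusion on a family of sets, as a relation whose field is that family.\<close>

definition reverse_inclusion_on :: "'a set set \<Rightarrow> 'a set rel" where
  "reverse_inclusion_on \<A> = {(A, B). A \<in> \<A> \<and> B \<in> \<A> \<and> B \<subseteq> A}"

definition decomposition_order :: "'a set \<Rightarrow> ('a \<Rightarrow> 'a \<Rightarrow> 'v) \<Rightarrow> 'a set rel" where
  "decomposition_order E v = reverse_inclusion_on (robust_modules E v)"

text \<open>
  The label \<open>v(R)\<close>. It is meaningful for a non-singleton robust \<open>R\<close> in a symmetric hereditary
  decomposable 2-structure: by \<open>tree_label_eqI\<close> below, a value with the defining property is then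
  the only one.
\<close>

definition tree_label :: "'a set \<Rightarrow> ('a \<Rightarrow> 'a \<Rightarrow> 'v) \<Rightarrow> 'a set \<Rightarrow> 'v" where
  "tree_label E v R =
     (THE c. \<forall>x\<in>E. \<forall>y\<in>E. x \<noteq> y \<and> least_strong_module E v x y R \<longrightarrow> v x y = c)"

lemma strong_module_singleton:
  assumes "x \<in> E"
  shows "strong_module E v {x}"
  using assms by (auto simp: strong_module_def is_module_def)

lemma robust_non_singletonE:
  assumes "R \<in> robust_modules E v" "\<not> is_singleton R"
  obtains x y where "x \<in> E" "y \<in> E" "x \<noteq> y" "least_strong_module E v x y R"
proof -
  obtain x y where xy: "x \<in> E" "y \<in> E" "least_strong_module E v x y R"
    using assms(1) by (auto simp: robust_modules_def)
  have "x \<noteq> y"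
  proof
    assume "x = y"
    then have "R \<subseteq> {x}" "x \<in> R"
      using xy strong_module_singleton[OF xy(1), of v]
      unfolding least_strong_module_def by blast+
    then have "R = {x}" by blast
    then show False using assms(2) by simp
  qed
  then show ?thesis using xy that by blast
qed

lemma tree_label_eqI:
  assumes "R \<in> robust_modules E v" "\<not> is_singleton R"
    and "\<And>x y. x \<in> E \<Longrightarrow> y \<in> E \<Longrightarrow> x \<noteq> y \<Longrightarrow> least_strong_module E v x y R \<Longrightarrow> v x y = c"
  shows "tree_label E v R = c"
  unfolding tree_label_def
proof (rule the_equality)
  show "\<forall>x\<in>E. \<forall>y\<in>E. x \<noteq> y \<and> least_strong_module E v x y R \<longrightarrow> v x y = c"
    using assms(3) by blast
next
  fix c'
  assume "\<forall>x\<in>E. \<forall>y\<in>E. x \<noteq> y \<and> least_strong_module E v x y R \<longrightarrow> v x y = c'"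
  with robust_non_singletonE[OF assms(1,2)] assms(3) show "c' = c" by metis
qed


section \<open>Ultrametric spaces\<close>

locale Ultrametric_space = Metric_space +
  assumes ultrametric:
    "\<And>x y z. \<lbrakk>x \<in> M; y \<in> M; z \<in> M\<rbrakk> \<Longrightarrow> d x z \<le> max (d x y) (d y z)"
begin

definition Spec :: "'a \<Rightarrow> real set" where
  "Spec a = d a ` M"

definition Nerv :: "'a set set" where
  "Nerv = {mcball a r | a r. a \<in> M \<and> r \<in> Spec a}"

text \<open>
  As for the type class constant \<^const>\<open>diameter\<close>, the value is only meaningful on bounded sets.
\<close>

definition mdiameter :: "'a set \<Rightarrow> real" where
  "mdiameter A = (if A = {} then 0 else SUP (x,y)\<in>A \<times> A. d x y)"

end

text \<open>
  An ultrametric space, labelled by its distance, is a 2-structure of the kind for which the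
  decomposition tree is considered.
\<close>

lemma (in Ultrametric_space) symmetric_structure: "symmetric_structure M d"
  by (simp add: symmetric_structure_def commute)

lemma (in Ultrametric_space) hereditary_decomposable: "hereditary_decomposable M d"
  unfolding hereditary_decomposable_def
proof (intro allI impI)
  fix F assume F: "F \<subseteq> M" "infinite F \<or> 3 \<le> card F"
  have more: "\<not> F \<subseteq> {x, y}" for x y
  proof
    assume "F \<subseteq> {x, y}"
    then have "finite F" "card F \<le> card {x, y}"
      by (auto intro: finite_subset card_mono)
    moreover have "card {x, y} \<le> 2" by (simp add: card_insert_if)
    ultimately show False using F(2) by linarith
  qed
  show "\<exists>A. nontrivial_module F d A"
  proof (cases "\<exists>x\<in>F. \<exists>y\<in>F. x \<noteq> y \<and> F \<inter> mcball x (d x y) \<noteq> F")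
    case True
    then obtain x y where xy: "x \<in> F" "y \<in> F" "x \<noteq> y" "F \<inter> mcball x (d x y) \<noteq> F" by blast
    let ?A = "F \<inter> mcball x (d x y)"
    have eq: "d z p = d z x" if "z \<in> F - ?A" "p \<in> ?A" for z p
    proof -
      have M: "x \<in> M" "z \<in> M" "p \<in> M" and "d x p \<le> d x y" "d x y < d x z"
        using that xy F(1) by auto
      then show ?thesis
        using ultrametric[OF M(2,1,3)] ultrametric[OF M(2,3,1)] commute[of p x] commute[of x z]
        by (auto simp: max_def split: if_splits)
    qed
    have "is_module F d ?A"
      unfolding is_module_def
    proof (intro conjI ballI)
      fix z p q assume "z \<in> F - ?A" "p \<in> ?A" "q \<in> ?A"
      then show "d z p = d z q" "d p z = d q z"
        using eq[of z p] eq[of z q] commute[of p z] commute[of q z] by simp_all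
    qed simp
    moreover have A: "x \<in> ?A" "y \<in> ?A" using xy F(1) by auto
    moreover have "\<not> is_singleton ?A"
      using A xy(3) by (metis is_singletonE singletonD)
    moreover have "?A \<noteq> {}" using A(1) by (metis empty_iff)
    ultimately have "nontrivial_module F d ?A"
      using xy(4) by (simp only: nontrivial_module_def not_False_eq_True simp_thms)
    then show ?thesis ..
  next
    case False
    obtain x where x: "x \<in> F" using more by blast
    obtain y where y: "y \<in> F" "y \<noteq> x" using more[of x x] by blast
    have le: "d p q \<le> d p r" if "p \<in> F" "q \<in> F" "r \<in> F" "p \<noteq> r" for p q r
    proof -
      have "q \<in> F \<inter> mcball p (d p r)" using False that by blast
      then show ?thesis by simp
    qed
    have "d z x = d z y" if "z \<in> F - {x, y}" for z
      using le[of z x y] le[of z y x] that x y by auto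
    then have "is_module F d {x, y}"
      using x y(1) commute unfolding is_module_def by auto
    moreover have "{x, y} \<noteq> F" using more by blast
    moreover have "\<not> is_singleton {x, y}"
      using y(2) by (metis insertCI is_singletonE singletonD)
    ultimately have "nontrivial_module F d {x, y}"
      by (simp add: nontrivial_module_def)
    then show ?thesis ..
  qed
qed

end

theory Submission
  imports Defs
begin

text \<open>
  The least strong module containing \<open>x\<close> and \<open>y\<close> is the closed ball with centre \<open>x\<close> and radius
  \<open>r = d x y\<close>. Closed balls are strong. Conversely, suppose that a strong module contains \<open>x\<close> and
  \<open>y\<close> but not a point \<open>z\<close> of this ball. As it is a module, \<open>z\<close> is at distance \<open>r\<close> from both \<open>x\<close> and
  \<open>y\<close>, so the union of the open balls of radius \<open>r\<close> around \<open>x\<close> and \<open>z\<close> is a module that contains \<open>x\<close>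
  and \<open>z\<close> but not \<open>y\<close>, contradicting strength.
\<close>

context Ultrametric_space
begin

text \<open>The two longest sides of an ultrametric triangle are equal, and \<open>d a p\<close> is
  not one of them.\<close>

lemma isosceles:
  assumes "z \<in> M" "a \<in> M" "p \<in> M" "d a p < d z a"
  shows "d z p = d z a"
  using assms ultrametric[of z a p] ultrametric[of z p a] commute[of a p]
  by (auto simp: max_def split: if_splits)

text \<open>Symmetry of \<open>d\<close> reduces the module condition to comparison with one
  reference point \<open>a\<close>.\<close>

lemma is_moduleI:
  assumes "A \<subseteq> M" and "\<And>z p. z \<in> M \<Longrightarrow> z \<notin> A \<Longrightarrow> p \<in> A \<Longrightarrow> d z p = d z a"
  shows "is_module M d A"
  unfolding is_module_def
proof (intro conjI ballI)
  fix z p q assume "z \<in> M - A" "p \<in> A" "q \<in> A"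
  then show "d z p = d z q" "d p z = d q z"
    using assms(2)[of z p] assms(2)[of z q] commute[of p z] commute[of q z] by simp_all
qed (fact assms(1))

lemma strong_module_mcball: "strong_module M d (mcball a r)"
  unfolding strong_module_def
proof (intro conjI allI impI)
  show "is_module M d (mcball a r)"
  proof (rule is_moduleI[where a = a])
    fix z p assume zp: "z \<in> M" "z \<notin> mcball a r" "p \<in> mcball a r"
    then have "a \<in> M" "p \<in> M" "d a p < d z a" using commute[of a z] by auto
    with zp(1) show "d z p = d z a" by (intro isosceles)
  qed auto
next
  fix B assume B: "is_module M d B \<and> mcball a r \<inter> B \<noteq> {}"
  then obtain c where c: "c \<in> mcball a r" "c \<in> B" by blast
  show "mcball a r \<subseteq> B \<or> B \<subseteq> mcball a r"
  proof (rule ccontr)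
    assume "\<not> ?thesis"
    then obtain u w where u: "u \<in> mcball a r" "u \<notin> B" and w: "w \<in> B" "w \<notin> mcball a r" by blast
    have M: "a \<in> M" "u \<in> M" "c \<in> M" "w \<in> M"
      using B u(1) c(1) w(1) by (auto simp: is_module_def)
    \<comment> \<open>The module \<open>B\<close> cannot separate \<open>c\<close> from
      \<open>w\<close> as seen from \<open>u\<close>. But \<open>u\<close> is also a centre of the
      ball, which contains \<open>c\<close> and not \<open>w\<close>.\<close>
    have "d u c = d u w"
      using B u(2) M(2) c(2) w(1) unfolding is_module_def by blast
    moreover have "d u c \<le> r"
      using ultrametric[OF M(2,1,3)] u(1) c(1) commute[of a u] by auto
    moreover have "r < d u w"
      using ultrametric[OF M(1,2,4)] u(1) w(2) M by auto
    ultimately show False by linarith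
  qed
qed

lemma is_module_Un_mball:
  assumes "x \<in> M" "z \<in> M"
  shows "is_module M d (mball x (d x z) \<union> mball z (d x z))"
proof (rule is_moduleI[where a = x])
  fix w p
  assume w: "w \<in> M" "w \<notin> mball x (d x z) \<union> mball z (d x z)"
    and p: "p \<in> mball x (d x z) \<union> mball z (d x z)"
  have far: "d x z \<le> d w x" "d x z \<le> d w z"
    using w assms commute[of x w] commute[of z w] by auto
  \<comment> \<open>\<open>isosceles\<close> needs a strict inequality, whereas \<open>d x z\<close>
    may equal the other two sides here.\<close>
  then have wz: "d w z = d w x"
    using ultrametric[of w x z] ultrametric[of w z x] assms w(1) commute[of x z] by auto
  from p show "d w p = d w x"
  proof
    assume "p \<in> mball x (d x z)"
    then show ?thesis using isosceles[of w x p] far w(1) by auto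
  next
    assume "p \<in> mball z (d x z)"
    then show ?thesis using isosceles[of w z p] far wz w(1) by auto
  qed
qed auto

lemma mcball_subset_strong_module:
  assumes S: "strong_module M d S" and xy: "x \<in> S" "y \<in> S"
  shows "mcball x (d x y) \<subseteq> S"
proof
  fix z assume z: "z \<in> mcball x (d x y)"
  show "z \<in> S"
  proof (rule ccontr)
    assume zS: "z \<notin> S"
    have M: "x \<in> M" "y \<in> M" "z \<in> M"
      using S xy z unfolding strong_module_def is_module_def by auto
    have zxy: "d z x = d z y"
      using S zS M(3) xy unfolding strong_module_def is_module_def by blast
    \<comment> \<open>The ball gives \<open>d x z\<close> \<le> \<open>d x y\<close>; the
      ultrametric inequality through \<open>z\<close>, with equal sides at \<open>z\<close>, gives
      the converse.\<close>
    have xz: "d x z = d x y" and zy: "d z y = d x y"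
      using zxy z ultrametric[OF M(1,3,2)] commute[of x z] by auto
    let ?A = "mball x (d x z) \<union> mball z (d x z)"
    \<comment> \<open>The radius \<open>d x z\<close> is thus positive, so each open ball contains
      its centre.\<close>
    have "z \<noteq> x" using zS xy by blast
    then have "x \<in> ?A" "z \<in> ?A" using M mdist_pos_less[of z x] commute[of z x] by auto
    moreover have "y \<notin> ?A" using xz zy by auto
    moreover have "S \<subseteq> ?A \<or> ?A \<subseteq> S"
      using S is_module_Un_mball[OF M(1,3)] xy(1) calculation(1)
      unfolding strong_module_def by blast
    ultimately show False using xy zS by blast
  qed
qed

lemma least_strong_module_iff:
  assumes "x \<in> M" "y \<in> M"
  shows "least_strong_module M d x y R \<longleftrightarrow> R = mcball x (d x y)"
proof -
  have "least_strong_module M d x y (mcball x (d x y))"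
    using assms strong_module_mcball mcball_subset_strong_module
    by (auto simp: least_strong_module_def)
  then show ?thesis unfolding least_strong_module_def by blast
qed

lemma robust_modules_eq_Nerv: "robust_modules M d = Nerv"
  by (auto simp: robust_modules_def Nerv_def Spec_def least_strong_module_iff)

text \<open>The pair \<open>x\<close>, \<open>y\<close> attains the supremum, and the ultrametric
  inequality through the centre \<open>x\<close> bounds all other distances.\<close>

lemma mdiameter_mcball:
  assumes "x \<in> M" "y \<in> M"
  shows "mdiameter (mcball x (d x y)) = d x y"
proof -
  let ?B = "mcball x (d x y)"
  have xy: "x \<in> ?B" "y \<in> ?B" using assms by auto
  have "(SUP (p, q)\<in>?B \<times> ?B. d p q) = d x y"
  proof (rule cSup_eq_maximum)
    show "d x y \<in> (\<lambda>(p, q). d p q) ` (?B \<times> ?B)" using xy by force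
  next
    fix t assume "t \<in> (\<lambda>(p, q). d p q) ` (?B \<times> ?B)"
    then obtain p q where "p \<in> ?B" "q \<in> ?B" "t = d p q" by auto
    then show "t \<le> d x y" using ultrametric[of p x q] commute[of p x] by auto
  qed
  moreover have "?B \<noteq> {}" using xy(1) by blast
  ultimately show ?thesis by (simp only: mdiameter_def if_False)
qed

lemma tree_label_eq_mdiameter:
  assumes "R \<in> robust_modules M d" "\<not> is_singleton R"
  shows "tree_label M d R = mdiameter R"
  using assms by (rule tree_label_eqI) (simp add: least_strong_module_iff mdiameter_mcball)

end

theorem proposition4:
  fixes M :: "'a set" and d :: "'a \<Rightarrow> 'a \<Rightarrow> real"
  assumes "Ultrametric_space M d"
  shows "robust_modules M d = Ultrametric_space.Nerv M d \<and>
         decomposition_order M d = reverse_inclusion_on (Ultrametric_space.Nerv M d) \<and>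
         (\<forall>R\<in>robust_modules M d. \<not> is_singleton R \<longrightarrow>
            tree_label M d R = Ultrametric_space.mdiameter d R)"
proof -
  interpret Ultrametric_space M d by (fact assms)
  show ?thesis
    using robust_modules_eq_Nerv tree_label_eq_mdiameter
    by (simp add: decomposition_order_def)
qed

end
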